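(* Let $I \subseteq \mathbf{R}$ be a non-empty interval, let $(U, \mathscr{A}, \alpha)$ be a measure space and $(V, \mathscr{B}, \beta)$ a probability space, and let $w: I \to \mathbf{R}$ be a continuous injection and $h: U \times V \to I$ a function. For $x \in U$ let $h_x$ be the map $V \to \mathbf{R}: y \mapsto h(x,y)$, and let $\varphi$ be the function $$\varphi: U \to \mathbf{R}: x \mapsto w^{-1}\!\left(\int_V w \circ h_x \, d\beta\right).$$ The following hold: (i) Suppose $w \circ h_x$ is $\beta$-integrable for every $x \in U$. Then $\varphi$ is well-defined and $\varphi[U] \subseteq I$. Moreover, if $h$ is $\mathscr{A}\otimes\mathscr{B}$-measurable and $w \circ h$ is bounded, then $\varphi$ is $\mathscr{A}$-measurable. (ii) Suppose that $h[U \times V]$ is contained in a compact subset of $I$ and that $h$ is $\mathscr{A}\otimes\mathscr{B}$-measurable. Then $\varphi[U] \subseteq I$, and $\varphi$ is $\mathscr{A}$-measurable and bounded.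
   Context: The interval $I$ may be bounded or unbounded, and need not be open or closed. For an injection $w: I \to \mathbf{R}$, $w^{-1}: w[I] \to I$ denotes the inverse of the corestriction of $w$ to its image $w[I]$. That $\varphi$ is well-defined means that, for each $x \in U$, the integral $\int_V w \circ h_x\,d\beta$ lies in $w[I]$, the domain of $w^{-1}$. Measures take only non-negative real values. Integration is in the sense of Lebesgue; a real-valued function is $\mathscr{C}$-measurable if it is measurable with respect to the sigma-algebra $\mathscr{C}$ and the Borel sigma-algebra of $\mathbf{R}$. For a function $F$ and a set $E$, $F[E]$ denotes the direct image of $E$ under $F$. *)

theory Defs
  imports "HOL-Probability.Probability_Measure"
begin

definition slice_fst :: "('a \<times> 'b \<Rightarrow> real) \<Rightarrow> 'a \<Rightarrow> 'b \<Rightarrow> real" where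
  "slice_fst h x = (\<lambda>y. h (x, y))"

definition quasi_mean ::
  "real set \<Rightarrow> (real \<Rightarrow> real) \<Rightarrow> 'b measure \<Rightarrow> ('a \<times> 'b \<Rightarrow> real) \<Rightarrow> 'a \<Rightarrow> real" where
  "quasi_mean I w \<beta> h x = inv_into I w (integral\<^sup>L \<beta> (w \<circ> slice_fst h x))"

text \<open>
  Both \<^term>\<open>integral\<^sup>L\<close> and \<^term>\<open>inv_into\<close> are total, with junk values for
  non-integrable functions and outside the image, so existence of the integral and its
  membership in the image have to be required explicitly.
\<close>

definition quasi_mean_well_defined ::
  "real set \<Rightarrow> (real \<Rightarrow> real) \<Rightarrow> 'a measure \<Rightarrow> 'b measure \<Rightarrow> ('a \<times> 'b \<Rightarrow> real) \<Rightarrow> bool" where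
  "quasi_mean_well_defined I w \<alpha> \<beta> h \<longleftrightarrow>
     (\<forall>x\<in>space \<alpha>. integrable \<beta> (w \<circ> slice_fst h x)
        \<and> integral\<^sup>L \<beta> (w \<circ> slice_fst h x) \<in> w ` I)"

end

theory Submission imports Defs begin

text \<open>
  Everything rests on one principle: the mean of an integrable function with values in a
  real interval \<open>J\<close>, taken with respect to a probability measure, lies in \<open>J\<close>, whether or
  not \<open>J\<close> contains its endpoints. For otherwise the mean \<open>m\<close> lies strictly to one side of \<open>J\<close>,
  so the function is everywhere strictly above or everywhere strictly below \<open>m\<close>, and then so
  is its mean, which is absurd (lemma \<open>expectation_in_interval\<close>).

  The image under \<open>w\<close> of a subinterval of \<open>I\<close> is again an interval, being connected. Hence
  if \<open>h\<close> takes values in a subinterval \<open>C\<close> of \<open>I\<close>, the mean of \<open>w \<circ> h\<^sub>x\<close> lies in the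
  interval \<open>w ` C\<close> and its preimage under \<open>w\<close> lies in \<open>C\<close> (lemma \<open>quasi_mean_in_subinterval\<close>).
  With \<open>C = I\<close> this gives well-definedness; with \<open>C\<close> the convex hull of a compact set
  containing the values of \<open>h\<close>, it gives boundedness, because convex hulls of compact sets
  are compact.

  For measurability, the parametrised integral \<open>x \<mapsto> \<integral> w \<circ> h\<^sub>x d\<beta>\<close> is measurable by the
  measurability part of Fubini's theorem, and a continuous injection on an interval has a
  continuous inverse (lemma \<open>borel_measurable_quasi_mean\<close>).
\<close>

text \<open>A mean \<open>m\<close> outside \<open>J\<close> would lie strictly to one side of \<open>f\<close>; total mass 1 makes
  \<open>m\<close> also the mean of the constant \<open>m\<close>, so strict monotonicity of the expectation would
  give \<open>m < m\<close>.\<close>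

lemma (in prob_space) expectation_in_interval:
  fixes f :: "'a \<Rightarrow> real"
  assumes J: "is_interval J" and f: "integrable M f" "f \<in> space M \<rightarrow> J"
  shows "expectation f \<in> J"
proof (rule ccontr)
  let ?m = "expectation f"
  assume m: "?m \<notin> J"
  have "(\<forall>t\<in>J. t < ?m) \<or> (\<forall>t\<in>J. ?m < t)"
    using J m by (metis is_interval_1 linorder_not_less)
  then show False
  proof
    assume "\<forall>t\<in>J. t < ?m"
    then have "?m < ?m"
      using f by (intro expectation_less) auto
    then show False by simp
  next
    assume "\<forall>t\<in>J. ?m < t"
    then have "?m < ?m"
      using f by (intro expectation_greater) auto
    then show False by simp
  qed
qed

lemma is_interval_continuous_image:
  fixes w :: "real \<Rightarrow> real"
  assumes "is_interval C" and "continuous_on C w"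
  shows "is_interval (w ` C)"
  using assms by (simp add: is_interval_connected_1 connected_continuous_image)

text \<open>The subinterval \<open>C\<close> is a separate parameter so that the lemma controls the values
  of the quasi-mean more sharply than by \<open>I\<close> itself.\<close>

lemma quasi_mean_in_subinterval:
  assumes "prob_space \<beta>" and "is_interval C" and "C \<subseteq> I"
    and "continuous_on I w" and "inj_on w I"
    and "integrable \<beta> (w \<circ> slice_fst h x)"
    and "slice_fst h x \<in> space \<beta> \<rightarrow> C"
  shows "integral\<^sup>L \<beta> (w \<circ> slice_fst h x) \<in> w ` C" and "quasi_mean I w \<beta> h x \<in> C"
proof -
  interpret \<beta>: prob_space \<beta> by fact
  have "is_interval (w ` C)"
    using assms by (blast intro: is_interval_continuous_image continuous_on_subset)
  then show mean: "integral\<^sup>L \<beta> (w \<circ> slice_fst h x) \<in> w ` C"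
    using assms by (intro \<beta>.expectation_in_interval) auto
  then obtain c where "c \<in> C" "integral\<^sup>L \<beta> (w \<circ> slice_fst h x) = w c"
    by blast
  then show "quasi_mean I w \<beta> h x \<in> C"
    using assms by (simp add: quasi_mean_def subset_iff)
qed

text \<open>An injective continuous real function on a path-connected set is a homeomorphism onto
  its image, and its inverse homeomorphism must agree with \<open>inv_into\<close> on that image.\<close>

lemma continuous_on_inv_into_interval:
  fixes w :: "real \<Rightarrow> real"
  assumes "is_interval I" and "continuous_on I w" and "inj_on w I"
  shows "continuous_on (w ` I) (inv_into I w)"
proof -
  obtain g where g: "homeomorphism I (w ` I) w g"
    using assms injective_into_1d_eq_homeomorphism[of I w]
    by (auto simp: is_interval_path_connected_1)
  then have "continuous_on (w ` I) g"
    by (simp add: homeomorphism_def)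
  moreover have "g y = inv_into I w y" if "y \<in> w ` I" for y
    using that g assms(3) by (auto simp: homeomorphism_def)
  ultimately show ?thesis
    by (simp cong: continuous_on_cong)
qed

text \<open>Neither \<open>w\<close> nor its inverse need be measurable on the whole line: continuity is only
  known on \<open>I\<close> and on \<open>w ` I\<close>. Measurability of a composition is therefore obtained
  through the trace sigma-algebra on the domain.\<close>

lemma borel_measurable_continuous_on_comp:
  assumes "continuous_on I w" and "f \<in> borel_measurable M" and "f \<in> space M \<rightarrow> I"
  shows "(\<lambda>x. w (f x)) \<in> borel_measurable M"
proof (rule measurable_compose[of f M "restrict_space borel I"])
  show "f \<in> measurable M (restrict_space borel I)"
    using assms by (intro measurable_restrict_space2) auto
  show "w \<in> borel_measurable (restrict_space borel I)"
    using assms by (intro borel_measurable_continuous_on_restrict)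
qed

text \<open>The quasi-mean is the parametrised integral followed by the continuous inverse of \<open>w\<close>;
  well-definedness is what keeps the integral inside the domain of that inverse.\<close>

lemma borel_measurable_quasi_mean:
  assumes "is_interval I" and "prob_space \<beta>"
    and "continuous_on I w" and "inj_on w I"
    and h: "h \<in> space \<alpha> \<times> space \<beta> \<rightarrow> I" "h \<in> borel_measurable (\<alpha> \<Otimes>\<^sub>M \<beta>)"
    and wd: "quasi_mean_well_defined I w \<alpha> \<beta> h"
  shows "quasi_mean I w \<beta> h \<in> borel_measurable \<alpha>"
proof -
  interpret \<beta>: prob_space \<beta> by fact
  have "(\<lambda>p. w (h p)) \<in> borel_measurable (\<alpha> \<Otimes>\<^sub>M \<beta>)"
    using h by (intro borel_measurable_continuous_on_comp[OF assms(3)])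
      (simp_all add: space_pair_measure)
  then have "(\<lambda>x. \<integral>y. w (h (x, y)) \<partial>\<beta>) \<in> borel_measurable \<alpha>"
    by (intro \<beta>.borel_measurable_lebesgue_integral) (simp add: case_prod_unfold)
  then have "(\<lambda>x. integral\<^sup>L \<beta> (w \<circ> slice_fst h x)) \<in> borel_measurable \<alpha>"
    by (simp add: slice_fst_def comp_def)
  then have "(\<lambda>x. inv_into I w (integral\<^sup>L \<beta> (w \<circ> slice_fst h x))) \<in> borel_measurable \<alpha>"
    using wd
    by (intro borel_measurable_continuous_on_comp
          [OF continuous_on_inv_into_interval[OF assms(1,3,4)]])
       (simp_all add: quasi_mean_well_defined_def)
  then show ?thesis
    by (simp add: quasi_mean_def[abs_def])
qed

text \<open>A measurable function with values in a compact subset of \<open>I\<close> becomes bounded after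
  composition with \<open>w\<close>, and bounded measurable functions are integrable for a finite measure.\<close>

lemma integrable_slice_of_compact_range:
  fixes w :: "real \<Rightarrow> real"
  assumes "prob_space \<beta>" and "continuous_on I w" and "compact K" and "K \<subseteq> I"
    and "h ` (space \<alpha> \<times> space \<beta>) \<subseteq> K" and "h \<in> borel_measurable (\<alpha> \<Otimes>\<^sub>M \<beta>)"
    and "x \<in> space \<alpha>"
  shows "integrable \<beta> (w \<circ> slice_fst h x)"
proof -
  interpret \<beta>: prob_space \<beta> by fact
  have cont: "continuous_on K w"
    using assms continuous_on_subset by blast
  then have "bounded (w ` K)"
    using assms by (simp add: compact_continuous_image compact_imp_bounded)
  then obtain B where B: "\<And>t. t \<in> K \<Longrightarrow> norm (w t) \<le> B"
    by (auto simp: bounded_iff)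
  have slice: "slice_fst h x \<in> space \<beta> \<rightarrow> K"
    using assms by (auto simp: slice_fst_def)
  have "slice_fst h x \<in> borel_measurable \<beta>"
    unfolding slice_fst_def using assms by simp
  then have "w \<circ> slice_fst h x \<in> borel_measurable \<beta>"
    using borel_measurable_continuous_on_comp[OF cont _ slice] by (simp add: comp_def)
  then show ?thesis
    using slice B by (intro \<beta>.integrable_const_bound[where B = B]) auto
qed

theorem proposition2:
  fixes I :: "real set"
    and \<alpha> :: "'a measure" and \<beta> :: "'b measure"
    and w :: "real \<Rightarrow> real"
    and h :: "'a \<times> 'b \<Rightarrow> real"
  assumes "is_interval I" and "I \<noteq> {}"
    and "finite_measure \<alpha>" and "prob_space \<beta>"
    and "continuous_on I w" and "inj_on w I"
    and "h \<in> space \<alpha> \<times> space \<beta> \<rightarrow> I"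
  shows
    "((\<forall>x\<in>space \<alpha>. integrable \<beta> (w \<circ> slice_fst h x)) \<longrightarrow>
        quasi_mean_well_defined I w \<alpha> \<beta> h
        \<and> quasi_mean I w \<beta> h ` space \<alpha> \<subseteq> I
        \<and> (h \<in> borel_measurable (\<alpha> \<Otimes>\<^sub>M \<beta>)
             \<and> bounded ((w \<circ> h) ` (space \<alpha> \<times> space \<beta>))
           \<longrightarrow> quasi_mean I w \<beta> h \<in> borel_measurable \<alpha>))
     \<and>
     ((\<exists>K. compact K \<and> K \<subseteq> I \<and> h ` (space \<alpha> \<times> space \<beta>) \<subseteq> K)
        \<and> h \<in> borel_measurable (\<alpha> \<Otimes>\<^sub>M \<beta>) \<longrightarrow>
        quasi_mean_well_defined I w \<alpha> \<beta> h
        \<and> quasi_mean I w \<beta> h ` space \<alpha> \<subseteq> I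
        \<and> quasi_mean I w \<beta> h \<in> borel_measurable \<alpha>
        \<and> bounded (quasi_mean I w \<beta> h ` space \<alpha>))"
proof (intro conjI impI; (elim conjE exE)?)
  have slice: "slice_fst h x \<in> space \<beta> \<rightarrow> I" if "x \<in> space \<alpha>" for x
    using assms(7) that by (auto simp: slice_fst_def)
  note in_I = quasi_mean_in_subinterval[OF assms(4,1) order_refl assms(5,6) _ slice]
  have range: "quasi_mean_well_defined I w \<alpha> \<beta> h \<and> quasi_mean I w \<beta> h ` space \<alpha> \<subseteq> I"
    if "\<forall>x\<in>space \<alpha>. integrable \<beta> (w \<circ> slice_fst h x)"
    using that in_I by (auto simp: quasi_mean_well_defined_def)
  note meas = borel_measurable_quasi_mean[OF assms(1,4,5,6,7)]
  {
    assume int: "\<forall>x\<in>space \<alpha>. integrable \<beta> (w \<circ> slice_fst h x)"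
    show "quasi_mean_well_defined I w \<alpha> \<beta> h" and "quasi_mean I w \<beta> h ` space \<alpha> \<subseteq> I"
      using range[OF int] by auto
    show "quasi_mean I w \<beta> h \<in> borel_measurable \<alpha>" if "h \<in> borel_measurable (\<alpha> \<Otimes>\<^sub>M \<beta>)"
      using meas that range[OF int] by blast
  next
    fix K
    assume K: "compact K" "K \<subseteq> I" "h ` (space \<alpha> \<times> space \<beta>) \<subseteq> K"
      and h: "h \<in> borel_measurable (\<alpha> \<Otimes>\<^sub>M \<beta>)"
    have int: "\<forall>x\<in>space \<alpha>. integrable \<beta> (w \<circ> slice_fst h x)"
      using integrable_slice_of_compact_range[OF assms(4,5) K h] by blast
    show "quasi_mean_well_defined I w \<alpha> \<beta> h" and "quasi_mean I w \<beta> h ` space \<alpha> \<subseteq> I"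
      using range[OF int] by auto
    show "quasi_mean I w \<beta> h \<in> borel_measurable \<alpha>"
      using meas h range[OF int] by blast
    \<comment> \<open>\<open>K\<close> need not be an interval, so the quasi-mean may leave \<open>K\<close>, but not its convex hull.\<close>
    have hull: "is_interval (convex hull K)" "convex hull K \<subseteq> I"
      using K assms(1) by (auto simp: is_interval_convex_1 hull_minimal)
    have "quasi_mean I w \<beta> h x \<in> convex hull K" if x: "x \<in> space \<alpha>" for x
    proof (rule quasi_mean_in_subinterval(2)[OF assms(4) hull assms(5,6)])
      show "integrable \<beta> (w \<circ> slice_fst h x)"
        using int x by blast
      show "slice_fst h x \<in> space \<beta> \<rightarrow> convex hull K"
        using K(3) x hull_subset[of K convex] by (fastforce simp: slice_fst_def)
    qed
    then show "bounded (quasi_mean I w \<beta> h ` space \<alpha>)"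
      using K(1) by (intro bounded_subset[OF bounded_convex_hull[OF compact_imp_bounded]]) auto
  }
qed

end
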